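(* There is a 0-dimensional Hausdorff space $Y$ such that $\chi(Y)\cdot\operatorname{nw}(Y)=\omega$ but $Y$ is not $\sigma$-second countable.
   Context: $\chi$ denotes character and $\operatorname{nw}$ network weight. A space is $\sigma$-second countable if it is the union of countably many subspaces, each of countable weight. *)

theory Defs
  imports "HOL-Analysis.Analysis"
begin

unbundle cardinal_syntax

no_notation elt_set_eq (infix "=o" 50)

text \<open>Cardinals are the cardinal orders of the library, so a cardinal defined as a minimum is
  determined only up to \<open>=o\<close>.\<close>

definition least_card :: "('k rel \<Rightarrow> bool) \<Rightarrow> 'k rel" where
  "least_card P =
     (SOME \<kappa>. Card_order \<kappa> \<and> P \<kappa> \<and> (\<forall>\<mu>. Card_order \<mu> \<and> P \<mu> \<longrightarrow> \<kappa> \<le>o \<mu>))"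

definition local_base :: "'a topology \<Rightarrow> 'a \<Rightarrow> 'a set set \<Rightarrow> bool" where
  "local_base X x \<B> \<longleftrightarrow>
     (\<forall>V\<in>\<B>. openin X V \<and> x \<in> V) \<and>
     (\<forall>U. openin X U \<and> x \<in> U \<longrightarrow> (\<exists>V\<in>\<B>. V \<subseteq> U))"

definition network :: "'a topology \<Rightarrow> 'a set set \<Rightarrow> bool" where
  "network X \<N> \<longleftrightarrow>
     (\<forall>N\<in>\<N>. N \<subseteq> topspace X) \<and>
     (\<forall>U x. openin X U \<and> x \<in> U \<longrightarrow> (\<exists>N\<in>\<N>. x \<in> N \<and> N \<subseteq> U))"

text \<open>Cardinal functions take infinite values only, as usual in set-theoretic topology. The
  summand \<^typ>\<open>nat\<close> makes room for an infinite cardinal even if \<open>'a\<close> is finite; any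
  family of subsets of \<open>'a\<close> has a cardinality represented on this type. The least \<open>\<kappa>\<close>
  bounding the characters of all points is their supremum.\<close>

definition character :: "'a topology \<Rightarrow> ('a set + nat) rel" where
  "character X = least_card (\<lambda>\<kappa>. natLeq \<le>o \<kappa> \<and>
     (\<forall>x\<in>topspace X. \<exists>\<B>. local_base X x \<B> \<and> |\<B>| \<le>o \<kappa>))"

definition network_weight :: "'a topology \<Rightarrow> ('a set + nat) rel" where
  "network_weight X = least_card (\<lambda>\<kappa>. natLeq \<le>o \<kappa> \<and> (\<exists>\<N>. network X \<N> \<and> |\<N>| \<le>o \<kappa>))"

definition zero_dimensional :: "'a topology \<Rightarrow> bool" where
  "zero_dimensional X \<longleftrightarrow> neighbourhood_base_of (\<lambda>U. closedin X U \<and> openin X U) X"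

definition sigma_second_countable :: "'a topology \<Rightarrow> bool" where
  "sigma_second_countable X \<longleftrightarrow>
     (\<exists>A :: nat \<Rightarrow> 'a set. (\<Union>n. A n) = topspace X \<and>
        (\<forall>n. second_countable (subtopology X (A n))))"

lemma least_card_props:
  assumes "Card_order \<mu>" "P \<mu>"
  shows "Card_order (least_card P) \<and> P (least_card P) \<and>
    (\<forall>\<nu>. Card_order \<nu> \<and> P \<nu> \<longrightarrow> least_card P \<le>o \<nu>)"
proof -
  have "\<exists>\<kappa>\<in>{\<kappa>. Card_order \<kappa> \<and> P \<kappa>}. \<forall>\<nu>\<in>{\<kappa>. Card_order \<kappa> \<and> P \<kappa>}. \<kappa> \<le>o \<nu>"
    by (rule exists_minim_Card_order) (use assms in auto)
  then have "\<exists>\<kappa>. Card_order \<kappa> \<and> P \<kappa> \<and> (\<forall>\<nu>. Card_order \<nu> \<and> P \<nu> \<longrightarrow> \<kappa> \<le>o \<nu>)"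
    by (simp add: Bex_def Ball_def)
  then show ?thesis
    unfolding least_card_def by (rule someI_ex)
qed

lemma card_of_le_large:
  fixes \<A> :: "'a set set"
  shows "|\<A>| \<le>o |UNIV :: ('a set + nat) set|"
  by (rule card_of_ordLeqI[where f = Inl]) (auto simp: inj_on_def)

lemma natLeq_le_large: "natLeq \<le>o |UNIV :: ('a set + nat) set|"
proof -
  have "|UNIV :: nat set| \<le>o |UNIV :: ('a set + nat) set|"
    by (rule card_of_ordLeqI[where f = Inr]) (auto simp: inj_on_def)
  then show ?thesis
    by (rule ordIso_ordLeq_trans[OF ordIso_symmetric[OF card_of_nat]])
qed

lemma character_props:
  fixes X :: "'a topology"
  shows "Card_order (character X) \<and>
    (natLeq \<le>o character X \<and>
      (\<forall>x\<in>topspace X. \<exists>\<B>. local_base X x \<B> \<and> |\<B>| \<le>o character X)) \<and>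
    (\<forall>\<nu> :: ('a set + nat) rel. Card_order \<nu> \<and> natLeq \<le>o \<nu> \<and>
      (\<forall>x\<in>topspace X. \<exists>\<B>. local_base X x \<B> \<and> |\<B>| \<le>o \<nu>) \<longrightarrow> character X \<le>o \<nu>)"
  unfolding character_def
proof (rule least_card_props)
  have "local_base X x {V. openin X V \<and> x \<in> V}" for x
    by (auto simp: local_base_def)
  note base = this
  show "natLeq \<le>o |UNIV :: ('a set + nat) set| \<and>
    (\<forall>x\<in>topspace X. \<exists>\<B>. local_base X x \<B> \<and> |\<B>| \<le>o |UNIV :: ('a set + nat) set| )"
    by (rule conjI[OF natLeq_le_large], rule ballI, rule exI, rule conjI[OF base card_of_le_large])
qed (rule card_of_Card_order)

lemma network_weight_props:
  fixes X :: "'a topology"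
  shows "Card_order (network_weight X) \<and>
    (natLeq \<le>o network_weight X \<and> (\<exists>\<N>. network X \<N> \<and> |\<N>| \<le>o network_weight X)) \<and>
    (\<forall>\<nu> :: ('a set + nat) rel. Card_order \<nu> \<and> natLeq \<le>o \<nu> \<and> (\<exists>\<N>. network X \<N> \<and> |\<N>| \<le>o \<nu>) \<longrightarrow>
      network_weight X \<le>o \<nu>)"
  unfolding network_weight_def
proof (rule least_card_props)
  have "network X {V. openin X V}"
    by (auto simp: network_def dest: openin_subset)
  note base = this
  show "natLeq \<le>o |UNIV :: ('a set + nat) set| \<and>
    (\<exists>\<N>. network X \<N> \<and> |\<N>| \<le>o |UNIV :: ('a set + nat) set| )"
    by (rule conjI[OF natLeq_le_large], rule exI, rule conjI[OF base card_of_le_large])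
qed (rule card_of_Card_order)

lemma natLeq_copy:
  obtains \<nu> :: "('a set + nat) rel" where "Card_order \<nu>" "\<nu> =o natLeq"
proof -
  have "bij_betw Inr (UNIV :: nat set) (range (Inr :: nat \<Rightarrow> 'a set + nat))"
    by (simp add: bij_betw_def)
  then have "|UNIV :: nat set| =o |range (Inr :: nat \<Rightarrow> 'a set + nat)|"
    by (rule card_of_ordIsoI)
  then have "|range (Inr :: nat \<Rightarrow> 'a set + nat)| =o natLeq"
    by (rule ordIso_transitive[OF ordIso_symmetric card_of_nat])
  then show ?thesis
    by (rule that[OF card_of_Card_order])
qed

lemma countable_iff_le_natLeq: "countable A \<longleftrightarrow> |A| \<le>o natLeq"
proof -
  have "countable A \<longleftrightarrow> |A| \<le>o |UNIV :: nat set|"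
    by (simp add: countable_def flip: card_of_ordLeq)
  also have "\<dots> \<longleftrightarrow> |A| \<le>o natLeq"
    using ordLeq_ordIso_trans[OF _ card_of_nat] ordLeq_ordIso_trans[OF _ ordIso_symmetric[OF card_of_nat]]
    by (rule iffI)
  finally show ?thesis .
qed

lemma first_countable_local_base:
  "first_countable X \<longleftrightarrow> (\<forall>x\<in>topspace X. \<exists>\<B>. local_base X x \<B> \<and> countable \<B>)"
proof
  assume X: "first_countable X"
  show "\<forall>x\<in>topspace X. \<exists>\<B>. local_base X x \<B> \<and> countable \<B>"
  proof
    fix x assume "x \<in> topspace X"
    then obtain \<B> where \<B>: "countable \<B>" "\<And>V. V \<in> \<B> \<Longrightarrow> openin X V"
      "\<And>U. openin X U \<Longrightarrow> x \<in> U \<Longrightarrow> \<exists>V\<in>\<B>. x \<in> V \<and> V \<subseteq> U"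
      using X unfolding first_countable_def by metis
    have "local_base X x {V\<in>\<B>. x \<in> V}"
      unfolding local_base_def using \<B>(2,3) by blast
    moreover have "countable {V\<in>\<B>. x \<in> V}"
      using \<B>(1) by simp
    ultimately show "\<exists>\<B>. local_base X x \<B> \<and> countable \<B>" by blast
  qed
next
  assume *: "\<forall>x\<in>topspace X. \<exists>\<B>. local_base X x \<B> \<and> countable \<B>"
  show "first_countable X"
    unfolding first_countable_def
  proof
    fix x assume "x \<in> topspace X"
    then obtain \<B> where "local_base X x \<B>" "countable \<B>"
      using * by blast
    then show "\<exists>\<B>. countable \<B> \<and> (\<forall>V\<in>\<B>. openin X V) \<and>
        (\<forall>U. openin X U \<and> x \<in> U \<longrightarrow> (\<exists>V\<in>\<B>. x \<in> V \<and> V \<subseteq> U))"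
      unfolding local_base_def by (intro exI[of _ \<B>]) simp
  qed
qed

lemma character_le_natLeq_iff: "character X \<le>o natLeq \<longleftrightarrow> first_countable X"
proof
  assume *: "character X \<le>o natLeq"
  show "first_countable X"
    unfolding first_countable_local_base countable_iff_le_natLeq
    using character_props[THEN conjunct2, THEN conjunct1, THEN conjunct2] ordLeq_transitive[OF _ *]
    by metis
next
  assume X: "first_countable X"
  obtain \<nu> :: "('a set + nat) rel" where \<nu>: "Card_order \<nu>" "\<nu> =o natLeq"
    by (rule natLeq_copy)
  have le: "natLeq \<le>o \<nu>"
    using \<nu>(2) by (simp add: ordIso_iff_ordLeq)
  have le': "|\<B>| \<le>o \<nu>" if "|\<B>| \<le>o natLeq" for \<B> :: "'a set set"
    by (rule ordLeq_transitive[OF that le])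
  have "\<forall>x\<in>topspace X. \<exists>\<B>. local_base X x \<B> \<and> |\<B>| \<le>o \<nu>"
    using X le' unfolding first_countable_local_base countable_iff_le_natLeq by metis
  then have "character X \<le>o \<nu>"
    by (intro character_props[THEN conjunct2, THEN conjunct2, rule_format] conjI \<nu>(1) le)
  then show "character X \<le>o natLeq"
    by (rule ordLeq_ordIso_trans[OF _ \<nu>(2)])
qed

lemma network_weight_le_natLeq_iff:
  "network_weight X \<le>o natLeq \<longleftrightarrow> (\<exists>\<N>. network X \<N> \<and> countable \<N>)"
proof
  assume *: "network_weight X \<le>o natLeq"
  show "\<exists>\<N>. network X \<N> \<and> countable \<N>"
    unfolding countable_iff_le_natLeq
    using network_weight_props[THEN conjunct2, THEN conjunct1, THEN conjunct2] ordLeq_transitive[OF _ *]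
    by metis
next
  assume X: "\<exists>\<N>. network X \<N> \<and> countable \<N>"
  obtain \<nu> :: "('a set + nat) rel" where \<nu>: "Card_order \<nu>" "\<nu> =o natLeq"
    by (rule natLeq_copy)
  have le: "natLeq \<le>o \<nu>"
    using \<nu>(2) by (simp add: ordIso_iff_ordLeq)
  have le': "|\<B>| \<le>o \<nu>" if "|\<B>| \<le>o natLeq" for \<B> :: "'a set set"
    by (rule ordLeq_transitive[OF that le])
  have "\<exists>\<N>. network X \<N> \<and> |\<N>| \<le>o \<nu>"
    using X le' unfolding countable_iff_le_natLeq by metis
  then have "network_weight X \<le>o \<nu>"
    by (intro network_weight_props[THEN conjunct2, THEN conjunct2, rule_format] conjI \<nu>(1) le)
  then show "network_weight X \<le>o natLeq"
    by (rule ordLeq_ordIso_trans[OF _ \<nu>(2)])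
qed

lemma character_times_network_weight_iff:
  "character X *c network_weight X =o natLeq \<longleftrightarrow>
     first_countable X \<and> (\<exists>\<N>. network X \<N> \<and> countable \<N>)"
proof -
  let ?c = "character X" and ?n = "network_weight X"
  have c: "Card_order ?c" "natLeq \<le>o ?c" and n: "Card_order ?n" "natLeq \<le>o ?n"
    by (simp_all only: character_props network_weight_props)
  have cz: "Cnotzero ?c" and nz: "Cnotzero ?n"
    by (intro Cinfinite_Cnotzero conjI cinfinite_mono[OF _ natLeq_cinfinite] c n)+
  have n_le: "?n \<le>o ?c *c ?n"
    by (rule ordLeq_cprod2[OF cz n(1)])
  have c_le: "?c \<le>o ?c *c ?n"
    by (rule ordLeq_ordIso_trans[OF ordLeq_cprod2[OF nz c(1)] cprod_com])
  have "?c *c ?n =o natLeq \<longleftrightarrow> ?c \<le>o natLeq \<and> ?n \<le>o natLeq"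
  proof
    assume *: "?c *c ?n =o natLeq"
    show "?c \<le>o natLeq \<and> ?n \<le>o natLeq"
      using ordLeq_ordIso_trans[OF c_le *] ordLeq_ordIso_trans[OF n_le *] by simp
  next
    assume *: "?c \<le>o natLeq \<and> ?n \<le>o natLeq"
    have "?c *c ?n \<le>o natLeq"
      using * c(1) n(1) natLeq_Cinfinite by (intro cprod_cinfinite_bound) simp_all
    then show "?c *c ?n =o natLeq"
      using ordLeq_transitive[OF c(2) c_le] by (simp add: ordIso_iff_ordLeq)
  qed
  then show ?thesis
    by (simp add: character_le_natLeq_iff network_weight_le_natLeq_iff)
qed

end

theory Submission
  imports Defs
begin

text \<open>Give \<open>\<nat> \<rightarrow> \<nat>\<close> the compact topology of \<open>(\<omega>+1)\<^sup>\<omega>\<close>, and refine it by admitting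
  \<open>y\<close> as a neighbour of \<open>x\<close> of order \<open>n\<close> only if the first \<open>n\<close> coordinates of \<open>y\<close> are closer to
  those of \<open>x\<close> than \<open>y\<close> is to \<open>x\<close>, as in a bow-tie space. Away from \<open>x\<close> this condition is clopen
  for the compact topology, so the refinement is zero-dimensional and first countable; it holds
  trivially if \<open>x\<close> and \<open>y\<close> have the same first \<open>n\<close> coordinates, so the cylinders of the Baire
  space form a countable network.

  If countably many sets \<open>A\<^sub>i\<close> with countable bases covered the space, take \<open>x\<close> generic in the
  Baire space, \<open>x \<in> A\<^sub>i\<close>. Then \<open>A\<^sub>i\<close> is dense in a cylinder around \<open>x\<close> of some length \<open>n\<close> with
  \<open>x\<^sub>n\<close> the limit point of \<open>\<omega>+1\<close>, and a single basic set \<open>V\<close> serves as a neighbourhood inside the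
  bow-ties of order \<open>n+1\<close> of a set \<open>C \<ni> x\<close> that is dense in a longer cylinder. Change \<open>x\<^sub>n\<close> by
  little and a later coordinate by more to get \<open>y \<in> V\<close>; the point \<open>z \<in> C\<close> that agrees with \<open>y\<close>
  in the later coordinates has \<open>y\<close> outside its bow-tie.\<close>

section \<open>Baire category for cylinders\<close>

definition cylinder :: "(nat \<Rightarrow> 'b) \<Rightarrow> nat \<Rightarrow> (nat \<Rightarrow> 'b) set" where
  "cylinder x m = {y. \<forall>i<m. y i = x i}"

lemma cylinder_self [simp]: "x \<in> cylinder x m"
  by (simp add: cylinder_def)

lemma cylinder_trans: "z \<in> cylinder y m \<Longrightarrow> y \<in> cylinder x k \<Longrightarrow> k \<le> m \<Longrightarrow> z \<in> cylinder x k"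
  by (simp add: cylinder_def)

definition dense_in_cylinder :: "(nat \<Rightarrow> 'b) set \<Rightarrow> (nat \<Rightarrow> 'b) \<Rightarrow> nat \<Rightarrow> bool" where
  "dense_in_cylinder C x m \<longleftrightarrow> (\<forall>z\<in>cylinder x m. \<forall>k. C \<inter> cylinder z k \<noteq> {})"

lemma dense_in_cylinder_mono:
  assumes "dense_in_cylinder C x m" "y \<in> cylinder x m" "m \<le> k"
  shows "dense_in_cylinder C y k"
  using assms cylinder_trans unfolding dense_in_cylinder_def by blast

text \<open>Baire category: the points of \<open>C p\<close> around which no cylinder has
  \<open>C p\<close> dense in it form a nowhere dense set, and \<open>x\<close> avoids countably
  many such sets.\<close>

lemma exists_generic_sequence:
  fixes C :: "nat \<Rightarrow> (nat \<Rightarrow> 'b) set"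
  shows "\<exists>x. \<forall>p. x \<in> C p \<longrightarrow> (\<exists>m. dense_in_cylinder (C p) x m)"
proof -
  \<comment> \<open>The pair \<open>s\<close> stands for \<open>cylinder (fst s) (snd s)\<close>.
    Stage \<open>p\<close> passes to a longer cylinder that misses \<open>C p\<close>, unless
    \<open>C p\<close> was dense in the old one.\<close>
  define Q :: "nat \<Rightarrow> (nat \<Rightarrow> 'b) \<times> nat \<Rightarrow> (nat \<Rightarrow> 'b) \<times> nat \<Rightarrow> bool" where
    "Q p s t \<longleftrightarrow> fst t \<in> cylinder (fst s) (snd s) \<and> snd s < snd t \<and>
       (C p \<inter> cylinder (fst t) (snd t) = {} \<or> dense_in_cylinder (C p) (fst s) (snd s))" for p s t
  have step: "\<exists>t. True \<and> Q p s t" for p s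
  proof (cases "dense_in_cylinder (C p) (fst s) (snd s)")
    case True
    then show ?thesis
      by (intro exI[of _ "(fst s, Suc (snd s))"]) (simp add: Q_def)
  next
    case False
    then obtain z k where zk: "z \<in> cylinder (fst s) (snd s)" "C p \<inter> cylinder z k = {}"
      unfolding dense_in_cylinder_def by blast
    moreover have "cylinder z (max k (Suc (snd s))) \<subseteq> cylinder z k"
      by (auto simp: cylinder_def)
    ultimately show ?thesis
      by (intro exI[of _ "(z, max k (Suc (snd s)))"]) (auto simp: Q_def)
  qed
  obtain s where s: "\<And>p. Q p (s p) (s (Suc p))"
    using dependent_nat_choice[of "\<lambda>_ _. True" Q] step by auto
  define z m where "z p = fst (s p)" and "m p = snd (s p)" for p
  have zSuc: "z (Suc p) \<in> cylinder (z p) (m p)" and mSuc: "m p < m (Suc p)" for p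
    using s[of p] by (auto simp: Q_def z_def m_def)
  have m_mono: "strict_mono m"
    by (simp add: strict_mono_Suc_iff mSuc)
  have z_later: "z (p + d) \<in> cylinder (z p) (m p)" for p d
  proof (induction d)
    case (Suc d)
    have "m p \<le> m (p + d)"
      using m_mono by (simp add: strict_mono_less_eq)
    then show ?case
      using cylinder_trans[OF zSuc Suc.IH] by simp
  qed simp
  \<comment> \<open>Coordinate \<open>i\<close> no longer changes from stage \<open>Suc i\<close>
    on, because \<open>i < m (Suc i)\<close>.\<close>
  define x where "x i = z (Suc i) i" for i
  have x: "x \<in> cylinder (z p) (m p)" for p
    unfolding cylinder_def
  proof (intro CollectI allI impI)
    fix i assume i: "i < m p"
    have "i < m (Suc i)"
      using strict_mono_imp_increasing[OF m_mono, of "Suc i"] by simp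
    then have "z (max p (Suc i)) i = z (Suc i) i"
      using z_later[of "Suc i" "max p (Suc i) - Suc i"] by (simp add: cylinder_def)
    moreover have "z (max p (Suc i)) i = z p i"
      using i z_later[of p "max p (Suc i) - p"] by (simp add: cylinder_def)
    ultimately show "x i = z p i"
      by (simp add: x_def)
  qed
  have "\<exists>k. dense_in_cylinder (C p) x k" if "x \<in> C p" for p
  proof -
    have "C p \<inter> cylinder (z (Suc p)) (m (Suc p)) \<noteq> {}"
      using that x[of "Suc p"] by blast
    then have "dense_in_cylinder (C p) (z p) (m p)"
      using s[of p] by (auto simp: Q_def z_def m_def)
    then show ?thesis
      using dense_in_cylinder_mono[OF _ x] by blast
  qed
  then show ?thesis by blast
qed

corollary exists_generic_point:
  fixes \<C> :: "(nat \<Rightarrow> 'b) set set"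
  assumes "countable \<C>"
  obtains x where "\<forall>C\<in>\<C>. x \<in> C \<longrightarrow> (\<exists>m. dense_in_cylinder C x m)"
proof (cases "\<C> = {}")
  case False
  then have "range (from_nat_into \<C>) = \<C>"
    using assms by (rule range_from_nat_into)
  then show ?thesis
    using exists_generic_sequence[of "from_nat_into \<C>"] that by (metis imageE)
qed (use that in blast)

section \<open>Resolutions of the compact topology, and bow-ties\<close>

text \<open>The number \<open>0\<close> encodes the limit point of \<open>\<omega>+1\<close>, and \<open>collapse k\<close> identifies it with
  all points of its neighbourhood \<open>{0} \<union> {k..}\<close>.\<close>

definition collapse :: "nat \<Rightarrow> nat \<Rightarrow> nat" where
  "collapse k a = (if a < k then a else 0)"

lemma collapse_antimono: "collapse l a = collapse l b \<Longrightarrow> k \<le> l \<Longrightarrow> collapse k a = collapse k b"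
  by (auto simp: collapse_def split: if_splits)

text \<open>Each relation has finitely many classes, and they get finer as \<open>k\<close> grows:
  the classes are the balls of an ultrametric for the compact topology.\<close>

definition agree :: "nat \<Rightarrow> (nat \<Rightarrow> nat) \<Rightarrow> (nat \<Rightarrow> nat) \<Rightarrow> bool" where
  "agree k x y \<longleftrightarrow> (\<forall>i<k. collapse k (x i) = collapse k (y i))"

lemma agree_refl [simp]: "agree k x x"
  by (simp add: agree_def)

lemma agree_sym: "agree k x y \<Longrightarrow> agree k y x"
  by (simp add: agree_def)

lemma agree_trans: "agree k x y \<Longrightarrow> agree k y z \<Longrightarrow> agree k x z"
  by (simp add: agree_def)

lemma agree_antimono: "agree l x y \<Longrightarrow> k \<le> l \<Longrightarrow> agree k x y"
  unfolding agree_def using collapse_antimono by (meson order_less_le_trans)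

lemma agree_imp_eq:
  assumes "\<And>k. agree k x y"
  shows "x = y"
proof
  fix i
  \<comment> \<open>A resolution above both values, at which \<open>collapse\<close> fixes
    them.\<close>
  have "collapse (Suc (i + x i + y i)) (x i) = collapse (Suc (i + x i + y i)) (y i)"
    using assms[of "Suc (i + x i + y i)"] by (simp add: agree_def)
  then show "x i = y i"
    by (simp add: collapse_def)
qed

lemma agree_level:
  assumes "x \<noteq> y"
  obtains k where "agree k x y" "\<not> agree (Suc k) x y"
proof -
  obtain l where "\<not> agree l x y"
    using assms agree_imp_eq by blast
  moreover have "agree 0 x y"
    by (simp add: agree_def)
  ultimately have "\<exists>k. agree k x y \<and> \<not> agree (Suc k) x y"
    by (induction l) auto
  then show ?thesis
    using that by blast
qed

lemma agree_level_unique: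
  assumes "agree k x y" "\<not> agree (Suc k) x y" "agree l x y" "\<not> agree (Suc l) x y"
  shows "k = l"
  using assms agree_antimono by (metis Suc_leI linorder_neqE_nat)

text \<open>The largest \<open>k\<close> with \<open>agree k x y\<close> measures the closeness of
  \<open>x\<close> and \<open>y\<close>. The first \<open>n\<close> coordinates still agree at
  resolution \<open>Suc k\<close>, so only a later one separates the points there.\<close>

definition bowtie :: "nat \<Rightarrow> (nat \<Rightarrow> nat) \<Rightarrow> (nat \<Rightarrow> nat) set" where
  "bowtie n x = {y. y = x \<or> (\<exists>k\<ge>n. agree k x y \<and> \<not> agree (Suc k) x y \<and>
     (\<forall>i<n. collapse (Suc k) (x i) = collapse (Suc k) (y i)))}"

lemma bowtie_self [simp]: "x \<in> bowtie n x"
  by (simp add: bowtie_def)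

lemma bowtie_mono: "n \<le> m \<Longrightarrow> bowtie m x \<subseteq> bowtie n x"
  unfolding bowtie_def by (auto simp: Suc_le_eq) (meson order_trans order_less_le_trans)

lemma bowtie_imp_agree: "y \<in> bowtie n x \<Longrightarrow> agree n x y"
  unfolding bowtie_def by (auto intro: agree_antimono)

lemma cylinder_subset_bowtie: "cylinder x n \<subseteq> bowtie n x"
proof
  fix y assume y: "y \<in> cylinder x n"
  show "y \<in> bowtie n x"
  proof (cases "y = x")
    case False
    then obtain k where k: "agree k x y" "\<not> agree (Suc k) x y"
      using agree_level by metis
    have "agree n x y"
      using y by (simp add: agree_def cylinder_def)
    then have "n \<le> k"
      using k(2) agree_antimono not_less_eq_eq by blast
    then show ?thesis
      using k y by (auto simp: bowtie_def cylinder_def)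
  qed simp
qed

text \<open>Points that agree with \<open>y\<close> at resolution \<open>Suc k\<close> have the same
  level \<open>k\<close> relative to \<open>x\<close>, and the defining condition looks at no finer
  resolution.\<close>

lemma bowtie_agree_iff:
  assumes "agree k x y" "\<not> agree (Suc k) x y" "agree (Suc k) y z"
  shows "z \<in> bowtie n x \<longleftrightarrow> y \<in> bowtie n x"
proof -
  have z: "agree k x z" "\<not> agree (Suc k) x z"
    using agree_trans[OF assms(1) agree_antimono[OF assms(3)]]
      agree_trans[OF _ agree_sym[OF assms(3)]] assms(2) by auto
  have iff: "w \<in> bowtie n x \<longleftrightarrow> n \<le> k \<and> (\<forall>i<n. collapse (Suc k) (x i) = collapse (Suc k) (w i))"
    if w: "agree k x w" "\<not> agree (Suc k) x w" for w
  proof -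
    have "w \<noteq> x"
      using w(2) by auto
    then show ?thesis
      unfolding bowtie_def using w agree_level_unique[OF w] by blast
  qed
  have "collapse (Suc k) (z i) = collapse (Suc k) (y i)" if "i < n" "n \<le> k" for i
    using assms(3) that by (simp add: agree_def)
  then show ?thesis
    unfolding iff[OF z] iff[OF assms(1,2)] by auto
qed

text \<open>Applied to \<open>y\<close> inside and outside a bow-tie, this makes bow-ties open and
  closed.\<close>

lemma bowtie_locally_constant:
  assumes "y \<noteq> x"
  obtains k where "\<forall>z\<in>bowtie k y. z \<in> bowtie n x \<longleftrightarrow> y \<in> bowtie n x"
proof -
  obtain k where "agree k x y" "\<not> agree (Suc k) x y"
    using assms agree_level by metis
  then show ?thesis
    using that[of "Suc k"] bowtie_agree_iff bowtie_imp_agree by blast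
qed

section \<open>The obstruction to countable bases\<close>

lemma bowtie_obstruction:
  assumes A: "dense_in_cylinder A x n" and C: "dense_in_cylinder C x M" and x: "x \<in> C" "x n = 0"
    and V: "\<And>z. z \<in> C \<Longrightarrow> bowtie m z \<inter> A \<subseteq> V \<and> V \<subseteq> bowtie (Suc n) z"
  shows False
proof -
  \<comment> \<open>\<open>n < K\<close> keeps the coordinates \<open>n\<close> and \<open>K\<close>
    apart, \<open>m \<le> K\<close> puts \<open>y\<close> into \<open>bowtie m x\<close>,
    \<open>M \<le> K\<close> puts \<open>z0\<close> into the cylinder where \<open>C\<close> is
    dense, and \<open>0 < K\<close> lets resolution \<open>Suc K\<close> tell 0 from 1.\<close>
  define K where "K = Suc (max M (max m n))"
  have K: "n < K" "m \<le> K" "M \<le> K" "0 < K"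
    by (auto simp: K_def)
  \<comment> \<open>\<open>y\<close> differs from \<open>x\<close> at resolution \<open>Suc (Suc K)\<close> in coordinate \<open>n\<close>, but already at
    resolution \<open>Suc K\<close> in coordinate \<open>K\<close>.\<close>
  define y0 where
    "y0 i = (if i = n then Suc K else if i = K then (if x K = 1 then 0 else 1) else x i)" for i
  have "y0 \<in> cylinder x n"
    using K by (simp add: cylinder_def y0_def)
  then obtain y where y: "y \<in> A" "y \<in> cylinder y0 (Suc K)"
    using A unfolding dense_in_cylinder_def by blast
  have yi: "y i = x i" if "i < K" "i \<noteq> n" for i
    using y(2) that by (simp add: cylinder_def y0_def)
  have yn: "y n = Suc K" and yK: "y K = (if x K = 1 then 0 else 1)"
    using y(2) K by (simp_all add: cylinder_def y0_def)
  have coll: "collapse k (x i) = collapse k (y i)" if "k \<le> Suc K" "i < K" for i k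
    using that yi yn x(2) by (cases "i = n") (auto simp: collapse_def)
  have "agree K x y"
    using coll by (simp add: agree_def)
  moreover have "\<not> agree (Suc K) x y"
  proof
    assume "agree (Suc K) x y"
    then have "collapse (Suc K) (x K) = collapse (Suc K) (y K)"
      by (simp add: agree_def)
    then show False
      using yK K by (simp add: collapse_def split: if_splits)
  qed
  ultimately have "y \<in> bowtie m x"
    using coll K by (auto simp: bowtie_def intro!: exI[of _ K])
  then have "y \<in> V"
    using V[OF x(1)] y(1) by blast
  \<comment> \<open>Below \<open>K\<close> this returns to \<open>x\<close>, so coordinate
    \<open>n\<close> is the limit point again; from \<open>K\<close> on it follows \<open>y\<close>,
    which removes the larger change.\<close>
  define z0 where "z0 i = (if i < K then x i else y i)" for i
  have "z0 \<in> cylinder x M"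
    using K by (simp add: cylinder_def z0_def)
  then obtain z where z: "z \<in> C" "z \<in> cylinder z0 (Suc K)"
    using C unfolding dense_in_cylinder_def by blast
  have zi: "z i = y i" if "i < Suc K" "i \<noteq> n" for i
    using z(2) that yi by (simp add: cylinder_def z0_def)
  have zn: "z n = 0"
    using z(2) K x(2) by (simp add: cylinder_def z0_def)
  have "y \<notin> bowtie (Suc n) z"
  proof
    assume "y \<in> bowtie (Suc n) z"
    moreover have "y \<noteq> z"
      using yn zn by auto
    ultimately obtain k where k: "\<not> agree (Suc k) z y"
      "collapse (Suc k) (z n) = collapse (Suc k) (y n)"
      unfolding bowtie_def by blast
    \<comment> \<open>Resolution \<open>Suc k\<close> cannot tell 0 from \<open>Suc K\<close>. At
      such resolutions \<open>z\<close> and \<open>y\<close> agree, since below \<open>Suc K\<close>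
      they differ only in coordinate \<open>n\<close>.\<close>
    then have "k \<le> K"
      using yn zn by (auto simp: collapse_def split: if_splits)
    then have "agree (Suc k) z y"
      unfolding agree_def using k(2) zi by (metis less_le_trans Suc_le_mono)
    then show False
      using k(1) by blast
  qed
  then show False
    using V[OF z(1)] \<open>y \<in> V\<close> by blast
qed

lemma no_countable_bowtie_bases:
  fixes A :: "nat \<Rightarrow> (nat \<Rightarrow> nat) set"
  assumes "\<And>i. countable (\<B> i)" "(\<Union>i. A i) = UNIV"
  shows "\<exists>i. \<exists>x\<in>A i. \<exists>n. \<forall>V\<in>\<B> i. \<forall>m. \<not> (bowtie m x \<inter> A i \<subseteq> V \<and> V \<subseteq> bowtie n x)"
proof (rule ccontr)
  assume neg: "\<not> ?thesis"
  \<comment> \<open>The points of \<open>A i\<close> served by the same \<open>V\<close> and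
    \<open>m\<close>. By \<open>neg\<close>, for each \<open>n\<close> countably many of these
    pieces cover \<open>A i\<close>.\<close>
  define piece where
    "piece i n V m = {x\<in>A i. bowtie m x \<inter> A i \<subseteq> V \<and> V \<subseteq> bowtie n x}" for i n m V
  \<comment> \<open>Nowhere dense sets: including them forces the generic \<open>x\<close> to take
    the limit value 0 at some coordinate at or beyond \<open>l\<close>.\<close>
  define tail where "tail n = {x :: nat \<Rightarrow> nat. \<forall>i\<ge>n. x i \<noteq> 0}" for n
  have "countable (range A \<union> range tail \<union> (\<Union>i n m. (\<lambda>V. piece i n V m) ` \<B> i))"
    using assms(1) by simp
  then obtain x where x: "\<forall>C\<in>range A \<union> range tail \<union> (\<Union>i n m. (\<lambda>V. piece i n V m) ` \<B> i).
      x \<in> C \<longrightarrow> (\<exists>m. dense_in_cylinder C x m)"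
    by (rule exists_generic_point)
  obtain i where i: "x \<in> A i"
    using assms(2) by blast
  then obtain l where l: "dense_in_cylinder (A i) x l"
    using bspec[OF x, of "A i"] by auto
  have "x \<notin> tail l"
  proof
    assume "x \<in> tail l"
    then obtain m where m: "dense_in_cylinder (tail l) x m"
      using bspec[OF x, of "tail l"] by auto
    \<comment> \<open>Sequences close to \<open>z\<close> vanish at coordinate
      \<open>max l m\<close>, hence lie outside \<open>tail l\<close>.\<close>
    define z where "z j = (if j < m then x j else 0)" for j
    have "z \<in> cylinder x m"
      by (simp add: cylinder_def z_def)
    then obtain w where "w \<in> tail l" "w \<in> cylinder z (Suc (max l m))"
      using m unfolding dense_in_cylinder_def by blast
    then show False
      by (auto simp: tail_def cylinder_def z_def dest!: spec[of _ "max l m"])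
  qed
  then obtain n where n: "l \<le> n" "x n = 0"
    by (auto simp: tail_def)
  obtain V m where V: "V \<in> \<B> i" "x \<in> piece i (Suc n) V m"
    using neg i unfolding piece_def by blast
  moreover from V(1) have "piece i (Suc n) V m \<in> (\<Union>i n m. (\<lambda>V. piece i n V m) ` \<B> i)"
    by blast
  ultimately obtain M where "dense_in_cylinder (piece i (Suc n) V m) x M"
    using bspec[OF x, of "piece i (Suc n) V m"] by blast
  then show False
    using bowtie_obstruction[OF dense_in_cylinder_mono[OF l cylinder_self n(1)] _ V(2) n(2)]
    unfolding piece_def by blast
qed

section \<open>The topology on a coded carrier\<close>

text \<open>The bijection allows a carrier such as \<open>real\<close> in place of the sequences
  themselves.\<close>

locale coding =
  fixes c :: "'a \<Rightarrow> nat \<Rightarrow> nat"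
  assumes bij_c: "bij c"
begin

lemma c_eq_iff [simp]: "c x = c y \<longleftrightarrow> x = y"
  using bij_c by (simp add: bij_def inj_eq)

definition nbhd :: "nat \<Rightarrow> 'a \<Rightarrow> 'a set" where
  "nbhd n x = c -` bowtie n (c x)"

definition bowtie_topology :: "'a topology" where
  "bowtie_topology = topology (\<lambda>U. \<forall>x\<in>U. \<exists>n. nbhd n x \<subseteq> U)"

lemma nbhd_self [simp]: "x \<in> nbhd n x"
  by (simp add: nbhd_def)

lemma nbhd_mono: "n \<le> m \<Longrightarrow> nbhd m x \<subseteq> nbhd n x"
  unfolding nbhd_def by (intro vimage_mono bowtie_mono)

lemma openin_bowtie: "openin bowtie_topology U \<longleftrightarrow> (\<forall>x\<in>U. \<exists>n. nbhd n x \<subseteq> U)"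
proof -
  have "istopology (\<lambda>U. \<forall>x\<in>U. \<exists>n. nbhd n x \<subseteq> U)"
    unfolding istopology_def
  proof (intro conjI allI impI ballI)
    fix S T x
    assume "\<forall>x\<in>S. \<exists>n. nbhd n x \<subseteq> S" "\<forall>x\<in>T. \<exists>n. nbhd n x \<subseteq> T" "x \<in> S \<inter> T"
    then obtain k l where "nbhd k x \<subseteq> S" "nbhd l x \<subseteq> T"
      by blast
    then have "nbhd (max k l) x \<subseteq> S \<inter> T"
      using nbhd_mono[of k "max k l" x] nbhd_mono[of l "max k l" x] by auto
    then show "\<exists>n. nbhd n x \<subseteq> S \<inter> T" ..
  next
    fix \<K> x
    assume \<K>: "\<forall>K\<in>\<K>. \<forall>x\<in>K. \<exists>n. nbhd n x \<subseteq> K" "x \<in> \<Union>\<K>"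
    then obtain K n where "K \<in> \<K>" "nbhd n x \<subseteq> K"
      by fast
    then show "\<exists>n. nbhd n x \<subseteq> \<Union>\<K>"
      by blast
  qed
  then show ?thesis
    by (simp add: bowtie_topology_def topology_inverse')
qed

lemma topspace_bowtie [simp]: "topspace bowtie_topology = UNIV"
proof -
  have "openin bowtie_topology UNIV"
    by (simp add: openin_bowtie)
  then show ?thesis
    using openin_subset by blast
qed

lemma nbhd_locally_constant:
  assumes "y \<noteq> x"
  obtains k where "\<forall>z\<in>nbhd k y. z \<in> nbhd n x \<longleftrightarrow> y \<in> nbhd n x"
proof -
  have "c y \<noteq> c x"
    using assms by simp
  then obtain k where k: "\<forall>z\<in>bowtie k (c y). z \<in> bowtie n (c x) \<longleftrightarrow> c y \<in> bowtie n (c x)"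
    by (rule bowtie_locally_constant[where n = n])
  show ?thesis
    unfolding nbhd_def by (rule that[of k, unfolded nbhd_def]) (use k in blast)
qed

lemma openin_nbhd: "openin bowtie_topology (nbhd n x)"
  unfolding openin_bowtie
proof
  fix y assume y: "y \<in> nbhd n x"
  show "\<exists>k. nbhd k y \<subseteq> nbhd n x"
  proof (cases "y = x")
    case False
    then obtain k where "\<forall>z\<in>nbhd k y. z \<in> nbhd n x \<longleftrightarrow> y \<in> nbhd n x"
      by (rule nbhd_locally_constant[where n = n])
    then show ?thesis
      using y by blast
  qed blast
qed

lemma closedin_nbhd: "closedin bowtie_topology (nbhd n x)"
proof -
  have "\<exists>k. nbhd k y \<subseteq> - nbhd n x" if "y \<notin> nbhd n x" for y
  proof -
    have "y \<noteq> x"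
      using that by auto
    then obtain k where "\<forall>z\<in>nbhd k y. z \<in> nbhd n x \<longleftrightarrow> y \<in> nbhd n x"
      by (rule nbhd_locally_constant[where n = n])
    then show ?thesis
      using that by blast
  qed
  then show ?thesis
    by (simp add: closedin_def openin_bowtie Compl_eq_Diff_UNIV[symmetric])
qed

lemma zero_dimensional_bowtie: "zero_dimensional bowtie_topology"
  unfolding zero_dimensional_def neighbourhood_base_of
proof (intro allI impI)
  fix W x assume "openin bowtie_topology W \<and> x \<in> W"
  then obtain n where "nbhd n x \<subseteq> W"
    by (auto simp: openin_bowtie)
  then show "\<exists>U V. openin bowtie_topology U \<and> (closedin bowtie_topology V \<and> openin bowtie_topology V) \<and>
      x \<in> U \<and> U \<subseteq> V \<and> V \<subseteq> W"
    using openin_nbhd closedin_nbhd nbhd_self by (intro exI[of _ "nbhd n x"]) simp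
qed

lemma Hausdorff_bowtie: "Hausdorff_space bowtie_topology"
  unfolding Hausdorff_space_def
proof (intro allI impI)
  fix x y assume "x \<in> topspace bowtie_topology \<and> y \<in> topspace bowtie_topology \<and> x \<noteq> y"
  then obtain k where "\<not> agree k (c x) (c y)"
    using agree_imp_eq[of "c x" "c y"] by auto
  then have "y \<notin> nbhd k x"
    using bowtie_imp_agree by (auto simp: nbhd_def)
  moreover have "openin bowtie_topology (- nbhd k x)"
    using closedin_nbhd[of k x] by (simp add: closedin_def Compl_eq_Diff_UNIV)
  ultimately show "\<exists>U V. openin bowtie_topology U \<and> openin bowtie_topology V \<and> x \<in> U \<and> y \<in> V \<and> disjnt U V"
    using openin_nbhd[of k x]
    by (intro exI[of _ "nbhd k x"] exI[of _ "- nbhd k x"]) (auto simp: disjnt_def)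
qed

lemma first_countable_bowtie: "first_countable bowtie_topology"
  unfolding first_countable_def
proof
  fix x
  show "\<exists>\<B>. countable \<B> \<and> (\<forall>V\<in>\<B>. openin bowtie_topology V) \<and>
      (\<forall>U. openin bowtie_topology U \<and> x \<in> U \<longrightarrow> (\<exists>V\<in>\<B>. x \<in> V \<and> V \<subseteq> U))"
    by (rule exI[of _ "range (\<lambda>n. nbhd n x)"]) (auto simp: openin_nbhd, auto simp: openin_bowtie)
qed

lemma countable_network_bowtie: "\<exists>\<N>. network bowtie_topology \<N> \<and> countable \<N>"
proof (intro exI conjI)
  \<comment> \<open>Indexing by finite lists makes the family countable; its members need not be
    open.\<close>
  define cyl where "cyl s = {y. map (c y) [0..<length s] = s}" for s
  show "countable (range cyl)"
    by simp
  show "network bowtie_topology (range cyl)"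
    unfolding network_def
  proof (intro conjI allI impI ballI)
    fix U x assume "openin bowtie_topology U \<and> x \<in> U"
    then obtain n where n: "nbhd n x \<subseteq> U"
      by (auto simp: openin_bowtie)
    define s where "s = map (c x) [0..<n]"
    have "cyl s \<subseteq> c -` cylinder (c x) n"
      by (auto simp: cyl_def s_def cylinder_def)
    also have "\<dots> \<subseteq> nbhd n x"
      using cylinder_subset_bowtie by (auto simp: nbhd_def)
    finally have "cyl s \<subseteq> U"
      using n by blast
    moreover have "x \<in> cyl s"
      by (simp add: cyl_def s_def)
    ultimately show "\<exists>N\<in>range cyl. x \<in> N \<and> N \<subseteq> U"
      by blast
  qed simp
qed

lemma not_sigma_second_countable_bowtie: "\<not> sigma_second_countable bowtie_topology"
proof
  assume "sigma_second_countable bowtie_topology"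
  then obtain A :: "nat \<Rightarrow> 'a set" where A: "(\<Union>i. A i) = UNIV"
    "\<forall>i. second_countable (subtopology bowtie_topology (A i))"
    by (auto simp: sigma_second_countable_def)
  from choice[OF A(2)[unfolded second_countable_def]]
  obtain \<B> where \<B>: "\<forall>i. countable (\<B> i) \<and>
      (\<forall>V\<in>\<B> i. openin (subtopology bowtie_topology (A i)) V) \<and>
      (\<forall>U x. openin (subtopology bowtie_topology (A i)) U \<and> x \<in> U \<longrightarrow> (\<exists>V\<in>\<B> i. x \<in> V \<and> V \<subseteq> U))"
    ..
  \<comment> \<open>Images under \<open>c\<close> carry the bases to sequences, where some bow-tie
    neighbourhood of a point contains no basic neighbourhood of it.\<close>
  have "countable ((`) c ` \<B> i)" for i
    using \<B> by simp
  moreover have "(\<Union>i. c ` A i) = UNIV"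
    using A(1) bij_is_surj[OF bij_c] by (simp flip: image_UN)
  ultimately obtain i u n where u: "u \<in> c ` A i"
    and bad: "\<forall>V\<in>(`) c ` \<B> i. \<forall>m. \<not> (bowtie m u \<inter> c ` A i \<subseteq> V \<and> V \<subseteq> bowtie n u)"
    using no_countable_bowtie_bases[of "\<lambda>i. (`) c ` \<B> i" "\<lambda>i. c ` A i"] by auto
  then obtain x where x: "x \<in> A i" "u = c x"
    by blast
  have "openin (subtopology bowtie_topology (A i)) (nbhd n x \<inter> A i)"
    unfolding openin_subtopology by (rule exI[of _ "nbhd n x"]) (simp add: openin_nbhd)
  moreover have "x \<in> nbhd n x \<inter> A i"
    using x by simp
  ultimately obtain V where V: "V \<in> \<B> i" "x \<in> V" "V \<subseteq> nbhd n x \<inter> A i"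
    using \<B>[THEN spec, THEN conjunct2, THEN conjunct2] by blast
  then obtain U where U: "openin bowtie_topology U" "V = U \<inter> A i"
    using \<B>[THEN spec, THEN conjunct2, THEN conjunct1, THEN bspec, OF V(1)] by (auto simp: openin_subtopology)
  then obtain m where m: "nbhd m x \<subseteq> U"
    using V(2) openin_bowtie[of U] by auto
  have "bowtie m (c x) \<inter> c ` A i \<subseteq> c ` V"
  proof
    fix v assume v: "v \<in> bowtie m (c x) \<inter> c ` A i"
    then obtain y where "y \<in> A i" "v = c y"
      by blast
    then show "v \<in> c ` V"
      using v m U(2) by (auto simp: nbhd_def)
  qed
  moreover have "c ` V \<subseteq> bowtie n (c x)"
    using V(3) by (auto simp: nbhd_def)
  ultimately show False
    using bad V(1) x(2) by blast
qed

end

text \<open>Schroeder-Bernstein through the power set of \<open>nat\<close>: characteristic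
  functions in one direction, coded graphs in the other.\<close>

lemma bij_real_sequences: "\<exists>c :: real \<Rightarrow> nat \<Rightarrow> nat. bij c"
proof -
  have "inj (\<lambda>(A :: nat set) i. of_bool (i \<in> A) :: nat)"
    by (auto simp: inj_on_def fun_eq_iff of_bool_eq_iff)
  then have "(UNIV :: nat set set) \<lesssim> (UNIV :: (nat \<Rightarrow> nat) set)"
    unfolding lepoll_def by blast
  moreover have "inj (\<lambda>f :: nat \<Rightarrow> nat. range (\<lambda>i. prod_encode (i, f i)))"
  proof (intro injI ext)
    fix f g :: "nat \<Rightarrow> nat" and i
    assume "range (\<lambda>i. prod_encode (i, f i)) = range (\<lambda>i. prod_encode (i, g i))"
    then have "prod_encode (i, f i) \<in> range (\<lambda>i. prod_encode (i, g i))"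
      by blast
    then show "f i = g i"
      by auto
  qed
  then have "(UNIV :: (nat \<Rightarrow> nat) set) \<lesssim> (UNIV :: nat set set)"
    unfolding lepoll_def by blast
  ultimately have "(UNIV :: nat set set) \<approx> (UNIV :: (nat \<Rightarrow> nat) set)"
    by (rule lepoll_antisym)
  with eqpoll_sym[OF nat_sets_eqpoll_reals] have "(UNIV :: real set) \<approx> (UNIV :: (nat \<Rightarrow> nat) set)"
    by (rule eqpoll_trans)
  then show ?thesis
    by (simp add: eqpoll_def)
qed

theorem theorem3p8:
  shows "\<exists>Y :: real topology. zero_dimensional Y \<and> Hausdorff_space Y \<and>
           character Y *c network_weight Y =o natLeq \<and> \<not> sigma_second_countable Y"
proof -
  obtain c :: "real \<Rightarrow> nat \<Rightarrow> nat" where "bij c"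
    using bij_real_sequences by blast
  then interpret coding c
    by unfold_locales
  show ?thesis
    using zero_dimensional_bowtie Hausdorff_bowtie first_countable_bowtie countable_network_bowtie
      not_sigma_second_countable_bowtie
    by (intro exI[of _ bowtie_topology]) (simp add: character_times_network_weight_iff)
qed

end
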